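(* Let $G$ be a finite simple connected graph with $m>0$ edges and minimum degree $\delta\ge 1$. Then $$DSO(G) \le \sqrt{\frac{m\,M_1(G)}{4\delta}}.$$ Equality holds if and only if $G$ is a regular graph.
   Context: For a finite simple graph $G=(V(G),E(G))$, $d_u$ denotes the degree of the vertex $u$. The Diminished Sombor index is $DSO(G)=\sum_{uv\in E(G)}\frac{\sqrt{d_u^2+d_v^2}}{d_u+d_v}$. The first Zagreb index is $M_1(G)=\sum_{v\in V(G)} d_v^2=\sum_{uv\in E(G)}(d_u+d_v)$. *)

theory Defs
  imports Complex_Main "Graph_Theory.Digraph_Component"
begin

(* A finite simple graph is a loop-free, symmetric digraph without parallel arcs
   (locale Digraph.graph), so each undirected edge uv is represented by two
   opposite arcs. Edges are counted and summed over as two-element sets {u, v},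
   hence once each. *)
definition uedges :: "('a, 'b) pre_digraph \<Rightarrow> 'a set set" where
  "uedges G = (\<lambda>a. {tail G a, head G a}) ` arcs G"

definition vertex_degree :: "('a, 'b) pre_digraph \<Rightarrow> 'a \<Rightarrow> nat" where
  "vertex_degree G v = card {e \<in> uedges G. v \<in> e}"

(* Only meaningful when G has finitely many, and at least one, vertices. *)
definition min_degree :: "('a, 'b) pre_digraph \<Rightarrow> nat" where
  "min_degree G = Min (vertex_degree G ` verts G)"

definition regular_graph :: "('a, 'b) pre_digraph \<Rightarrow> bool" where
  "regular_graph G \<longleftrightarrow> (\<exists>r. \<forall>v \<in> verts G. vertex_degree G v = r)"

(* The inner sums range over the two distinct ends of the edge e = {u, v}:
   they are d_u^2 + d_v^2 and d_u + d_v. *)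
definition DSO :: "('a, 'b) pre_digraph \<Rightarrow> real" where
  "DSO G = (\<Sum>e \<in> uedges G.
     sqrt (\<Sum>v \<in> e. (real (vertex_degree G v))\<^sup>2) / (\<Sum>v \<in> e. real (vertex_degree G v)))"

definition first_Zagreb :: "('a, 'b) pre_digraph \<Rightarrow> nat" where
  "first_Zagreb G = (\<Sum>v \<in> verts G. (vertex_degree G v)\<^sup>2)"

end

theory Submission
  imports Defs "HOL-Analysis.Convex"
begin

text \<open>
  Write \<open>k\<close> for the minimum degree and \<open>m\<close> for the number of edges. Cauchy--Schwarz bounds
  \<open>DSO\<^sup>2\<close> by \<open>m\<close> times the sum of the squared edge weights
  \<open>(a\<^sup>2 + b\<^sup>2) / (a + b)\<^sup>2\<close>, where \<open>a\<close> and \<open>b\<close> are the degrees of the ends. The elementary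
  inequality \<open>squared_weight_le\<close> bounds each squared weight by \<open>(a + b) / (4 k)\<close>, and
  double counting (\<open>first_Zagreb_eq_sum_edges\<close>) turns the sum of these bounds into
  \<open>M\<^sub>1 / (4 k)\<close>.

  If the two sides agree, then the elementary inequality is an equality at every edge, which
  forces both ends of the edge to have degree \<open>k\<close>; since \<open>k \<ge> 1\<close>, every vertex lies
  on an edge, so the graph is regular. Conversely, in a regular graph all edge weights equal
  \<open>sqrt (1 / 2)\<close>.
\<close>

text \<open>
  For \<open>b \<le> a\<close> everything follows from the identity
  \<open>(a + b)\<^sup>3 - 4 k (a\<^sup>2 + b\<^sup>2) = (a - b) (a\<^sup>2 + 3 b\<^sup>2) + 4 (b - k) (a\<^sup>2 + b\<^sup>2)\<close>,
  whose right-hand side is a sum of two nonnegative terms that vanish together only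
  for \<open>a = b = k\<close>.
\<close>

lemma squared_weight_le_ordered:
  fixes a b k :: real
  assumes "0 < k" "k \<le> b" "b \<le> a"
  shows "(a\<^sup>2 + b\<^sup>2) / (a + b)\<^sup>2 \<le> (a + b) / (4 * k)"
    and "(a\<^sup>2 + b\<^sup>2) / (a + b)\<^sup>2 = (a + b) / (4 * k) \<longleftrightarrow> a = k \<and> b = k"
proof -
  have pos: "0 < a" "0 < b" "0 < a + b" using assms by auto
  define p where "p = (a - b) * (a\<^sup>2 + 3 * b\<^sup>2)"
  define q where "q = 4 * (b - k) * (a\<^sup>2 + b\<^sup>2)"
  have sq: "0 < a\<^sup>2 + 3 * b\<^sup>2" "0 < a\<^sup>2 + b\<^sup>2"
    using pos by (simp_all add: add_pos_pos)
  have p: "0 \<le> p" "p = 0 \<longleftrightarrow> a = b"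
    using assms sq unfolding p_def by (auto simp: less_imp_le)
  have q: "0 \<le> q" "q = 0 \<longleftrightarrow> b = k"
    using assms sq unfolding q_def by (auto simp: less_imp_le)
  have "(a + b) / (4 * k) - (a\<^sup>2 + b\<^sup>2) / (a + b)\<^sup>2
      = ((a + b) ^ 3 - 4 * k * (a\<^sup>2 + b\<^sup>2)) / (4 * k * (a + b)\<^sup>2)"
    using pos assms diff_frac_eq[of "4 * k" "(a + b)\<^sup>2" "a + b" "a\<^sup>2 + b\<^sup>2"]
    by (simp add: power2_eq_square power3_eq_cube mult.commute mult.left_commute)
  also have "(a + b) ^ 3 - 4 * k * (a\<^sup>2 + b\<^sup>2) = p + q"
    unfolding p_def q_def by (simp add: algebra_simps power2_eq_square power3_eq_cube)
  finally have diff: "(a + b) / (4 * k) - (a\<^sup>2 + b\<^sup>2) / (a + b)\<^sup>2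
      = (p + q) / (4 * k * (a + b)\<^sup>2)" .
  have den: "0 < 4 * k * (a + b)\<^sup>2" using pos assms by simp
  have "0 \<le> (p + q) / (4 * k * (a + b)\<^sup>2)"
    using p(1) q(1) den by simp
  then show "(a\<^sup>2 + b\<^sup>2) / (a + b)\<^sup>2 \<le> (a + b) / (4 * k)"
    using diff by linarith
  have "(a\<^sup>2 + b\<^sup>2) / (a + b)\<^sup>2 = (a + b) / (4 * k) \<longleftrightarrow> (p + q) / (4 * k * (a + b)\<^sup>2) = 0"
    using diff by linarith
  also have "\<dots> \<longleftrightarrow> p + q = 0"
    using den by (metis divide_eq_0_iff less_irrefl)
  also have "\<dots> \<longleftrightarrow> a = k \<and> b = k"
    using p q by (auto simp: add_nonneg_eq_0_iff)
  finally show "(a\<^sup>2 + b\<^sup>2) / (a + b)\<^sup>2 = (a + b) / (4 * k) \<longleftrightarrow> a = k \<and> b = k" .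
qed

lemma squared_weight_le:
  fixes a b k :: real
  assumes "0 < k" "k \<le> a" "k \<le> b"
  shows "(a\<^sup>2 + b\<^sup>2) / (a + b)\<^sup>2 \<le> (a + b) / (4 * k)"
    and "(a\<^sup>2 + b\<^sup>2) / (a + b)\<^sup>2 = (a + b) / (4 * k) \<longleftrightarrow> a = k \<and> b = k"
proof -
  have "(a\<^sup>2 + b\<^sup>2) / (a + b)\<^sup>2 \<le> (a + b) / (4 * k) \<and>
      ((a\<^sup>2 + b\<^sup>2) / (a + b)\<^sup>2 = (a + b) / (4 * k) \<longleftrightarrow> a = k \<and> b = k)"
  proof (cases "b \<le> a")
    case True
    then show ?thesis using squared_weight_le_ordered[of k b a] assms by blast
  next
    case False
    then show ?thesis using squared_weight_le_ordered[of k a b] assms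
      by (simp add: add.commute conj_commute)
  qed
  then show "(a\<^sup>2 + b\<^sup>2) / (a + b)\<^sup>2 \<le> (a + b) / (4 * k)"
    and "(a\<^sup>2 + b\<^sup>2) / (a + b)\<^sup>2 = (a + b) / (4 * k) \<longleftrightarrow> a = k \<and> b = k" by auto
qed

context digraph
begin

lemma finite_uedges: "finite (uedges G)"
  unfolding uedges_def by simp

lemma uedgesE:
  assumes "e \<in> uedges G"
  obtains u v where "e = {u, v}" "u \<noteq> v" "u \<in> verts G" "v \<in> verts G"
  using assms no_loops tail_in_verts head_in_verts unfolding uedges_def by blast

lemma min_degree_le:
  assumes "v \<in> verts G"
  shows "min_degree G \<le> vertex_degree G v"
  using assms unfolding min_degree_def by simp

text \<open>Both sides sum \<open>d\<^sub>v\<close> over the incident pairs of a vertex \<open>v\<close> and an edge.\<close>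

lemma first_Zagreb_eq_sum_edges:
  "first_Zagreb G = (\<Sum>e \<in> uedges G. \<Sum>v \<in> e. vertex_degree G v)"
proof -
  have "first_Zagreb G = (\<Sum>v \<in> verts G. \<Sum>e \<in> {e \<in> uedges G. v \<in> e}. vertex_degree G v)"
    unfolding first_Zagreb_def by (simp add: power2_eq_square flip: vertex_degree_def)
  also have "\<dots> = (\<Sum>e \<in> uedges G. \<Sum>v \<in> {v \<in> verts G. v \<in> e}. vertex_degree G v)"
    by (rule sum.swap_restrict) (simp_all add: finite_uedges)
  also have "\<dots> = (\<Sum>e \<in> uedges G. \<Sum>v \<in> e. vertex_degree G v)"
  proof (rule sum.cong[OF refl])
    fix e assume "e \<in> uedges G"
    then have "{v \<in> verts G. v \<in> e} = e" by (auto elim: uedgesE)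
    then show "(\<Sum>v \<in> {v \<in> verts G. v \<in> e}. vertex_degree G v) = (\<Sum>v \<in> e. vertex_degree G v)"
      by simp
  qed
  finally show ?thesis .
qed

lemma squared_edge_weight_le:
  assumes "e \<in> uedges G" and "min_degree G \<ge> 1"
  defines "x \<equiv> (sqrt (\<Sum>v \<in> e. (real (vertex_degree G v))\<^sup>2) / (\<Sum>v \<in> e. real (vertex_degree G v)))\<^sup>2"
    and "y \<equiv> (\<Sum>v \<in> e. real (vertex_degree G v)) / (4 * real (min_degree G))"
  shows "x \<le> y" and "x = y \<longleftrightarrow> (\<forall>v \<in> e. vertex_degree G v = min_degree G)"
proof -
  obtain u v where e: "e = {u, v}" "u \<noteq> v" "u \<in> verts G" "v \<in> verts G"
    using assms(1) by (rule uedgesE)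
  define a b k where "a = real (vertex_degree G u)" and "b = real (vertex_degree G v)"
    and "k = real (min_degree G)"
  have k: "0 < k" "k \<le> a" "k \<le> b"
    using assms(2) min_degree_le e(3,4) unfolding a_def b_def k_def by auto
  have x: "x = (a\<^sup>2 + b\<^sup>2) / (a + b)\<^sup>2"
    using e(1,2) by (simp add: x_def a_def b_def power_divide)
  have y: "y = (a + b) / (4 * k)"
    using e(1,2) by (simp add: y_def a_def b_def k_def)
  show "x \<le> y" unfolding x y by (rule squared_weight_le(1)[OF k])
  have "x = y \<longleftrightarrow> a = k \<and> b = k" unfolding x y by (rule squared_weight_le(2)[OF k])
  then show "x = y \<longleftrightarrow> (\<forall>v \<in> e. vertex_degree G v = min_degree G)"
    using e(1) by (simp add: a_def b_def k_def)
qed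

lemma regular_graph_iff_edges:
  assumes "min_degree G \<ge> 1"
  shows "regular_graph G \<longleftrightarrow> (\<forall>e \<in> uedges G. \<forall>v \<in> e. vertex_degree G v = min_degree G)"
proof
  assume "regular_graph G"
  then obtain r where r: "\<And>v. v \<in> verts G \<Longrightarrow> vertex_degree G v = r"
    unfolding regular_graph_def by blast
  have "min_degree G = r" if "v \<in> verts G" for v
  proof -
    have "vertex_degree G ` verts G = {r}" using r that by force
    then show ?thesis unfolding min_degree_def by simp
  qed
  then show "\<forall>e \<in> uedges G. \<forall>v \<in> e. vertex_degree G v = min_degree G"
    using r by (auto elim!: uedgesE)
next
  assume edges: "\<forall>e \<in> uedges G. \<forall>v \<in> e. vertex_degree G v = min_degree G"
  have "vertex_degree G v = min_degree G" if "v \<in> verts G" for v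
  proof -
    \<comment> \<open>A positive minimum degree puts every vertex on some edge.\<close>
    have "card {e \<in> uedges G. v \<in> e} \<noteq> 0"
      using min_degree_le[OF that] assms unfolding vertex_degree_def by linarith
    then have "{e \<in> uedges G. v \<in> e} \<noteq> {}" by (metis card.empty)
    then show ?thesis using edges by blast
  qed
  then show "regular_graph G" unfolding regular_graph_def by blast
qed

end

theorem theorem6:
  fixes G :: "('a, 'b) pre_digraph"
  assumes "Digraph.graph G"
    and "Digraph_Component.connected G"
    and "card (uedges G) > 0"
    and "min_degree G \<ge> 1"
  shows "DSO G \<le> sqrt (real (card (uedges G)) * real (first_Zagreb G) / (4 * real (min_degree G)))
    \<and> (DSO G = sqrt (real (card (uedges G)) * real (first_Zagreb G) / (4 * real (min_degree G)))
        \<longleftrightarrow> regular_graph G)"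
proof -
  interpret graph G by (rule assms(1))
  define d where "d v = real (vertex_degree G v)" for v
  define k where "k = real (min_degree G)"
  define m where "m = real (card (uedges G))"
  define w where "w e = sqrt (\<Sum>v \<in> e. (d v)\<^sup>2) / (\<Sum>v \<in> e. d v)" for e
  define y where "y e = (\<Sum>v \<in> e. d v) / (4 * k)" for e
  define B where "B = m * real (first_Zagreb G) / (4 * k)"
  have m: "0 < m" using assms(3) by (simp add: m_def)
  have k: "0 < k" using assms(4) by (simp add: k_def)
  have DSO: "DSO G = (\<Sum>e \<in> uedges G. w e)"
    unfolding DSO_def w_def d_def ..
  have DSO_nonneg: "0 \<le> DSO G"
    unfolding DSO w_def d_def by (intro sum_nonneg divide_nonneg_nonneg) (auto intro: sum_nonneg)
  have B: "B = m * (\<Sum>e \<in> uedges G. y e)"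
    unfolding B_def y_def d_def first_Zagreb_eq_sum_edges by (simp flip: sum_divide_distrib)
  have le: "(w e)\<^sup>2 \<le> y e"
    and eq: "(w e)\<^sup>2 = y e \<longleftrightarrow> (\<forall>v \<in> e. vertex_degree G v = min_degree G)"
    if "e \<in> uedges G" for e
    using squared_edge_weight_le[OF that assms(4)] unfolding w_def y_def d_def k_def by auto
  have CS: "(DSO G)\<^sup>2 \<le> m * (\<Sum>e \<in> uedges G. (w e)\<^sup>2)"
    unfolding DSO m_def using sum_squared_le_sum_of_squares[of w "uedges G"]
    by (simp add: mult.commute)
  have sum_le: "(\<Sum>e \<in> uedges G. (w e)\<^sup>2) \<le> (\<Sum>e \<in> uedges G. y e)"
    by (rule sum_mono) (rule le)
  have bound: "(DSO G)\<^sup>2 \<le> B"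
    using CS sum_le m unfolding B by (meson mult_left_mono order.trans less_imp_le)
  have "DSO G = sqrt B \<longleftrightarrow> regular_graph G"
  proof
    assume "DSO G = sqrt B"
    then have "(DSO G)\<^sup>2 = B"
      using bound by (metis order.trans real_sqrt_pow2 zero_le_power2)
    then have "m * (\<Sum>e \<in> uedges G. y e) \<le> m * (\<Sum>e \<in> uedges G. (w e)\<^sup>2)"
      using CS unfolding B by simp
    then have sums: "(\<Sum>e \<in> uedges G. (w e)\<^sup>2) = (\<Sum>e \<in> uedges G. y e)"
      using sum_le m by (simp add: mult_le_cancel_left_pos)
    have "(w e)\<^sup>2 = y e" if "e \<in> uedges G" for e
      by (rule sum_mono_inv[OF sums le that finite_uedges])
    then show "regular_graph G"
      using eq regular_graph_iff_edges[OF assms(4)] by blast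
  next
    assume "regular_graph G"
    then have deg: "\<forall>v \<in> e. vertex_degree G v = min_degree G" if "e \<in> uedges G" for e
      using that regular_graph_iff_edges[OF assms(4)] by blast
    have y: "y e = 1 / 2" if e: "e \<in> uedges G" for e
    proof -
      obtain u v where "e = {u, v}" "u \<noteq> v" using e by (rule uedgesE)
      then show ?thesis using deg[OF e] k unfolding y_def d_def k_def by simp
    qed
    have w: "w e = sqrt (1 / 2)" if e: "e \<in> uedges G" for e
    proof -
      have "(w e)\<^sup>2 = 1 / 2" using eq[OF e] deg[OF e] y[OF e] by simp
      moreover have "0 \<le> w e"
        unfolding w_def d_def by (intro divide_nonneg_nonneg) (auto intro: sum_nonneg)
      ultimately show ?thesis by (metis real_sqrt_unique)
    qed
    have "DSO G = m * sqrt (1 / 2)" unfolding DSO m_def by (simp add: w)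
    also have "\<dots> = sqrt (m\<^sup>2 * (1 / 2))"
      using m by (simp only: real_sqrt_mult real_sqrt_abs abs_of_pos)
    also have "m\<^sup>2 * (1 / 2) = B" unfolding B by (simp add: y m_def power2_eq_square)
    finally show "DSO G = sqrt B" .
  qed
  moreover have "DSO G \<le> sqrt B" using bound by (rule real_le_rsqrt)
  ultimately show ?thesis unfolding B_def m_def k_def by blast
qed

end
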